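(* Let $\mathbf{P}=(p_1,\dots,p_m)$ be a finite vector of distinct primes. For each integer $n\ge 2$ let $a_n=1$ if the tower expansion of $n$ is a tower over $\mathbf{P}$ (i.e. every prime occurring anywhere, at any level, in the tower expansion of $n$ belongs to $\{p_1,\dots,p_m\}$), and $a_n=0$ otherwise. Then $$1+\sum_{n\ge 2} \frac{a_n}{n}<\infty .$$
   Context: Every integer $n>1$ has a unique tower expansion over the primes: $n=\prod_{i} q_i^{E_i}$ with distinct primes $q_i$ (in increasing order), where each exponent $E_i$ is either omitted (exponent $1$) or is recursively the tower expansion of an integer $e_i>1$. For instance $16=2^{2^{2}}$ and $2^{6}=2^{2\cdot 3}$. The primes occurring in the tower expansion of $n$ are all primes appearing at any level of this nested expression. (In the paper, the integers with $a_n=1$ are those whose towers appear in the formal limit $\lim_{k\to\infty}G_k(\mathbf{P})=1+\sum_{n\ge2}a_n T_{\mathbf{P}}(n)$, where $G_0(\mathbf{P})=\prod_k(1+g(p_k))$, $g(x)=1+x+x^x+x^{x^x}+\cdots$, and $G_{k+1}(\mathbf{P})=\prod_k\bigl(1+\sum_{T} p_k^{T}\bigr)$ with $T$ running over the towers in $G_k(\mathbf{P})$.) *)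

theory Defs
  imports "HOL-Analysis.Analysis" "HOL-Computational_Algebra.Primes"
begin

text \<open>
  \<open>Tower [(q\<^sub>1, E\<^sub>1), \<dots>, (q\<^sub>r, E\<^sub>r)]\<close> stands for the formal product of the \<open>q\<^sub>i ^ E\<^sub>i\<close>,
  with \<open>None\<close> for an omitted exponent. The set function \<open>tower_primes\<close> generated by the
  datatype package collects the labels \<open>q\<close> occurring at every nesting level.
\<close>

datatype (tower_primes: 'a) tower = Tower "('a \<times> 'a tower option) list"

primrec tower_value :: "nat tower \<Rightarrow> nat" where
  "tower_value (Tower fs) =
     prod_list (map (\<lambda>(q, e). q ^ (case e of None \<Rightarrow> 1 | Some v \<Rightarrow> v))
       (map (map_prod id (map_option tower_value)) fs))"

inductive tower_wf :: "nat tower \<Rightarrow> bool" where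
  "fs \<noteq> [] \<Longrightarrow> sorted_wrt (<) (map fst fs) \<Longrightarrow> (\<And>q e. (q, e) \<in> set fs \<Longrightarrow> prime q) \<Longrightarrow>
   (\<And>q t. (q, Some t) \<in> set fs \<Longrightarrow> tower_wf t) \<Longrightarrow> tower_wf (Tower fs)"

lemma multiplicity_less_self:
  fixes n q :: nat
  assumes "q \<in> prime_factors n"
  shows "multiplicity q n < n"
proof -
  have "n \<noteq> 0" using assms by (cases "n = 0") auto
  moreover have "prime q" using assms by auto
  ultimately have "n > 0" by simp
  then have "q ^ multiplicity q n \<le> n"
    by (intro dvd_imp_le multiplicity_dvd) auto
  moreover have "multiplicity q n < q ^ multiplicity q n"
    using prime_gt_1_nat[OF \<open>prime q\<close>] by (intro power_gt_expt) auto
  ultimately show ?thesis by simp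
qed

text \<open>Only meaningful for \<open>n > 1\<close>; the values at \<open>0\<close> and \<open>1\<close> are the empty product.\<close>

function tower_expansion :: "nat \<Rightarrow> nat tower" where
  "tower_expansion n =
     Tower (map (\<lambda>q. (q, if multiplicity q n = 1 then None
                         else Some (tower_expansion (multiplicity q n))))
       (sorted_list_of_set (prime_factors n)))"
  by auto
termination
  by (relation "Wellfounded.measure (\<lambda>n. n)") (auto intro: multiplicity_less_self)

declare tower_expansion.simps [simp del]

lemma tower_expansion_correct:
  assumes "n > 1"
  shows "tower_wf (tower_expansion n)" and "tower_value (tower_expansion n) = n"
proof -
  have "tower_wf (tower_expansion n) \<and> tower_value (tower_expansion n) = n"
    using assms
  proof (induction n rule: less_induct)
    case (less n)
    let ?e = "\<lambda>q. if multiplicity q n = 1 then None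
                  else Some (tower_expansion (multiplicity q n))"
    let ?qs = "sorted_list_of_set (prime_factors n)"
    have eq: "tower_expansion n = Tower (map (\<lambda>q. (q, ?e q)) ?qs)"
      by (rule tower_expansion.simps)
    have IH: "tower_wf (tower_expansion (multiplicity q n))"
             "tower_value (tower_expansion (multiplicity q n)) = multiplicity q n"
      if "q \<in> prime_factors n" "multiplicity q n \<noteq> 1" for q
    proof -
      have "multiplicity q n \<noteq> 0"
        using that(1) less.prems
        by (auto simp: prime_factors_multiplicity)
      then have "multiplicity q n > 1" using that(2) by linarith
      then show "tower_wf (tower_expansion (multiplicity q n))"
             "tower_value (tower_expansion (multiplicity q n)) = multiplicity q n"
        using less.IH[OF multiplicity_less_self[OF that(1)]] by auto
    qed
    have ne: "prime_factors n \<noteq> {}"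
      using less.prems by (simp add: prime_factorization_empty_iff)
    have "tower_wf (tower_expansion n)"
      unfolding eq
    proof (rule tower_wf.intros)
      show "map (\<lambda>q. (q, ?e q)) ?qs \<noteq> []" using ne by simp
      show "sorted_wrt (<) (map fst (map (\<lambda>q. (q, ?e q)) ?qs))"
        by (simp add: comp_def)
    qed (use IH(1) in \<open>auto split: if_splits\<close>)
    moreover have "tower_value (tower_expansion n) = prod_list (map (\<lambda>q. q ^ multiplicity q n) ?qs)"
      unfolding eq tower_value.simps map_map
      by (intro arg_cong[where f = prod_list] map_cong refl) (auto simp: IH)
    moreover have "\<dots> = (\<Prod>q\<in>prime_factors n. q ^ multiplicity q n)"
      by (subst prod.distinct_set_conv_list[symmetric]) auto
    moreover have "\<dots> = n"
      using less.prems by (intro prime_factorization_nat[symmetric]) auto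
    ultimately show ?case by simp
  qed
  then show "tower_wf (tower_expansion n)" and "tower_value (tower_expansion n) = n" by auto
qed

lemma tower_expansion_unique:
  assumes "tower_wf t"
  shows "tower_value t > 1" and "tower_expansion (tower_value t) = t"
proof -
  have "tower_value t > 1 \<and> tower_expansion (tower_value t) = t"
    using assms
  proof (induction rule: tower_wf.induct)
    case (1 fs)
    let ?v = "\<lambda>e. case map_option tower_value e of None \<Rightarrow> 1 | Some v \<Rightarrow> v"
    define n where "n = tower_value (Tower fs)"
    define A where "A = set (map fst fs)"
    have srt: "sorted (map fst fs)" and dist: "distinct (map fst fs)"
      using "1.hyps"(2) by (auto simp: strict_sorted_iff)
    define g where "g = (\<lambda>q. ?v (the (map_of fs q)))"
    have gv: "g q = ?v e" if "(q, e) \<in> set fs" for q e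
      using that dist by (simp add: g_def)
    have gpos: "g q > 0" if "q \<in> A" for q
    proof -
      have "q \<in> fst ` set fs" using that by (simp add: A_def)
      then obtain e where e: "(q, e) \<in> set fs" by (auto simp: image_iff)
      show ?thesis
      proof (cases e)
        case None
        then show ?thesis using gv[OF e] by simp
      next
        case (Some t)
        then have "tower_value t > 1" using "1.IH" e by blast
        then show ?thesis using gv[OF e] Some by simp
      qed
    qed
    have "n = prod_list (map (\<lambda>q. q ^ g q) (map fst fs))"
      unfolding n_def tower_value.simps map_map
      by (intro arg_cong[where f = prod_list] map_cong refl) (auto simp: gv)
    also have "\<dots> = (\<Prod>q\<in>A. q ^ g q)"
      unfolding A_def using dist by (subst prod.distinct_set_conv_list) auto
    finally have n: "n = (\<Prod>q\<in>A. q ^ g q)" .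
    have fin: "finite A" by (simp add: A_def)
    have pr: "prime q" if "q \<in> A" for q using that "1.hyps"(3) by (auto simp: A_def)
    have mult: "multiplicity q n = g q" if "q \<in> A" for q
      unfolding n using that fin pr by (subst multiplicity_prod_prime_powers) auto
    have mult0: "multiplicity q n = 0" if "q \<notin> A" "prime q" for q
      unfolding n using that fin pr by (subst multiplicity_prod_prime_powers) auto
    have "q \<in> prime_factors n \<longleftrightarrow> q \<in> A" for q
      using mult[of q] mult0[of q] gpos[of q] pr[of q]
      by (cases "q \<in> A") (auto simp: prime_factors_multiplicity)
    then have pf: "prime_factors n = A" by blast
    have "A \<noteq> {}" using "1.hyps"(1) by (simp add: A_def)
    then have "n \<noteq> 0" "n \<noteq> 1" using pf by auto
    then have "n > 1" by linarith
    have qs: "sorted_list_of_set A = map fst fs"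
      unfolding A_def using srt dist by (simp only: sorted_list_of_set.idem_if_sorted_distinct)
    have "tower_expansion n =
            Tower (map (\<lambda>q. (q, if g q = 1 then None else Some (tower_expansion (g q)))) (map fst fs))"
      unfolding tower_expansion.simps[of n] pf qs tower.inject
    proof (rule map_cong[OF refl])
      fix q assume "q \<in> set (map fst fs)"
      then have "multiplicity q n = g q" by (intro mult) (simp add: A_def)
      then show "(q, if multiplicity q n = 1 then None else Some (tower_expansion (multiplicity q n))) =
            (q, if g q = 1 then None else Some (tower_expansion (g q)))" by (simp only:)
    qed
    also have "map (\<lambda>q. (q, if g q = 1 then None else Some (tower_expansion (g q)))) (map fst fs) = fs"
      unfolding map_map
    proof (rule map_idI, clarify)
      fix q e assume e: "(q, e) \<in> set fs"
      show "((\<lambda>q. (q, if g q = 1 then None else Some (tower_expansion (g q)))) \<circ> fst) (q, e) = (q, e)"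
      proof (cases e)
        case None
        then show ?thesis using gv[OF e] by simp
      next
        case (Some t)
        then have "tower_value t > 1 \<and> tower_expansion (tower_value t) = t" using "1.IH" e by blast
        then show ?thesis using gv[OF e] Some by simp
      qed
    qed
    finally show ?case using \<open>n > 1\<close> by (simp add: n_def)
  qed
  then show "tower_value t > 1" and "tower_expansion (tower_value t) = t" by auto
qed

definition tower_over :: "nat list \<Rightarrow> nat tower \<Rightarrow> bool" where
  "tower_over P t \<longleftrightarrow> tower_primes t \<subseteq> set P"

definition tower_coeff :: "nat list \<Rightarrow> nat \<Rightarrow> real" where
  "tower_coeff P n = (if tower_over P (tower_expansion n) then 1 else 0)"

end

(* Forgetting all levels of the towers but the first only enlarges the sum: an integer whose tower
   is over P has its prime factors in P, and the reciprocals of these integers sum to the Euler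
   product of the factors 1 / (1 - 1 / p) \<le> 2 over P. *)

theory Submission
  imports Defs
begin

text \<open>The prime factors of \<open>n\<close> are the labels of the outermost level, so a single
  unfolding exhibits them.\<close>

lemma prime_factors_subset_tower_primes:
  "prime_factors n \<subseteq> tower_primes (tower_expansion n)"
  by (subst tower_expansion.simps) auto

text \<open>Comparison with the geometric series of ratio 1/2 makes the bound uniform in both
  \<open>p\<close> and \<open>N\<close>.\<close>

lemma sum_inverse_power_le_2:
  fixes p :: nat
  assumes "p \<ge> 2"
  shows "(\<Sum>k\<le>N. 1 / real (p ^ k)) \<le> 2"
proof -
  have "(\<Sum>k\<le>N. 1 / real (p ^ k)) \<le> (\<Sum>k\<le>N. (1/2) ^ k)"
    using assms
    by (intro sum_mono) (auto simp: power_one_over frac_le power_mono)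
  also have "\<dots> \<le> (\<Sum>k. (1/2) ^ k :: real)"
    by (intro sum_le_suminf) auto
  also have "\<dots> = 2"
    by (simp add: suminf_geometric)
  finally show ?thesis .
qed

text \<open>By unique factorization the terms over \<open>X\<close> are distinct terms in the
  expansion of a product of truncated geometric sums, one for each prime in \<open>A\<close>. The
  bound is independent of \<open>X\<close>, so it applies to all partial sums at once.\<close>

lemma sum_inverse_smooth_le:
  fixes A X :: "nat set"
  assumes "finite A" "\<And>p. p \<in> A \<Longrightarrow> prime p" "finite X"
    and X: "\<And>n. n \<in> X \<Longrightarrow> n > 0 \<and> prime_factors n \<subseteq> A"
  shows "(\<Sum>n\<in>X. 1 / real n) \<le> 2 ^ card A"
proof -
  \<comment> \<open>Inserting 0 keeps the maximum meaningful when \<open>X\<close> is empty.\<close>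
  define N where "N = Max (insert 0 X)"
  \<comment> \<open>Restricting to \<open>A\<close> places the exponent vectors in an extensional
    function space, as the product expansion needs.\<close>
  define \<mu> where "\<mu> = (\<lambda>n::nat. \<lambda>q\<in>A. multiplicity q n)"
  have prod_\<mu>: "(\<Prod>q\<in>A. q ^ \<mu> n q) = n" if "n \<in> X" for n
  proof -
    \<comment> \<open>Primes of \<open>A\<close> not dividing \<open>n\<close> contribute
      \<open>q ^ 0 = 1\<close>.\<close>
    have "(\<Prod>q\<in>A. q ^ \<mu> n q) = (\<Prod>q\<in>prime_factors n. q ^ multiplicity q n)"
      using X[OF that] assms(1,2)
      by (intro prod.mono_neutral_cong_right)
         (auto simp: \<mu>_def prime_factors_multiplicity)
    also have "\<dots> = n"
      using X[OF that] by (intro prime_factorization_nat[symmetric]) auto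
    finally show ?thesis .
  qed
  then have inj: "inj_on \<mu> X"
    by (intro inj_onI) metis
  have "multiplicity q n \<le> N" if "n \<in> X" "q \<in> A" for q n
  proof (cases "q \<in> prime_factors n")
    case True
    then have "multiplicity q n \<le> n"
      using multiplicity_less_self less_imp_le by blast
    also have "n \<le> N"
      using that assms(3) by (simp add: N_def)
    finally show ?thesis .
  next
    case False
    then show ?thesis
      using that assms(2) by (simp add: prime_factors_multiplicity)
  qed
  then have sub: "\<mu> ` X \<subseteq> (\<Pi>\<^sub>E q\<in>A. {..N})"
    by (auto simp: \<mu>_def)
  have "(\<Sum>n\<in>X. 1 / real n) = (\<Sum>n\<in>X. \<Prod>q\<in>A. 1 / real (q ^ \<mu> n q))"
  proof (intro sum.cong refl)
    fix n assume "n \<in> X"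
    then have "real n = (\<Prod>q\<in>A. real (q ^ \<mu> n q))"
      by (simp only: prod_\<mu> flip: of_nat_prod)
    then show "1 / real n = (\<Prod>q\<in>A. 1 / real (q ^ \<mu> n q))"
      by (simp only: prod_dividef prod.neutral_const)
  qed
  also have "\<dots> = (\<Sum>f\<in>\<mu> ` X. \<Prod>q\<in>A. 1 / real (q ^ f q))"
    using inj by (simp add: sum.reindex)
  \<comment> \<open>Passing to the full box of exponents only adds nonnegative terms, and the sum
    over the box factors by distributivity.\<close>
  also have "\<dots> \<le> (\<Sum>f\<in>(\<Pi>\<^sub>E q\<in>A. {..N}). \<Prod>q\<in>A. 1 / real (q ^ f q))"
    using sub assms(1) by (intro sum_mono2) (auto intro!: finite_PiE prod_nonneg)
  also have "\<dots> = (\<Prod>q\<in>A. \<Sum>k\<le>N. 1 / real (q ^ k))"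
    using assms(1) by (intro prod_sum_PiE[symmetric]) auto
  also have "\<dots> \<le> (\<Prod>q\<in>A. 2)"
    using assms(2) prime_ge_2_nat by (intro prod_mono conjI sum_inverse_power_le_2 sum_nonneg) auto
  finally show ?thesis
    by simp
qed

theorem mainTheorem2:
  fixes P :: "nat list"
  assumes "distinct P" and "\<And>p. p \<in> set P \<Longrightarrow> prime p"
  shows "1 + (\<Sum>n. ennreal (tower_coeff P (n + 2) / real (n + 2))) < \<infinity>"
proof -
  let ?f = "\<lambda>n. tower_coeff P (n + 2) / real (n + 2)"
  have nonneg: "?f n \<ge> 0" for n
    by (simp add: tower_coeff_def)
  have "(\<Sum>n<N. ?f n) \<le> 2 ^ card (set P)" for N
  proof -
    define X where "X = {n \<in> {2..<N + 2}. tower_over P (tower_expansion n)}"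
    have "(\<Sum>n<N. ?f n) = (\<Sum>n\<in>{2..<N + 2}. tower_coeff P n / real n)"
      by (rule sum.reindex_bij_witness[of _ "\<lambda>n. n - 2" "\<lambda>n. n + 2"]) auto
    also have "\<dots> = (\<Sum>n\<in>X. 1 / real n)"
      unfolding X_def by (intro sum.mono_neutral_cong_right) (auto simp: tower_coeff_def)
    also have "\<dots> \<le> 2 ^ card (set P)"
      using assms(2) prime_factors_subset_tower_primes
      by (intro sum_inverse_smooth_le) (auto simp: X_def tower_over_def)
    finally show ?thesis .
  qed
  then have "summable ?f"
    using nonneg by (intro summableI_nonneg_bounded)
  \<comment> \<open>Summability turns the extended sum into \<open>ennreal\<close> of a real series;
    rewriting 1 as \<open>ennreal 1\<close> makes the whole expression the image of a real
    number.\<close>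
  then show ?thesis
    using nonneg by (simp add: suminf_ennreal2 ennreal_1[symmetric] del: ennreal_1)
qed

end
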